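(* Assume Data (D1)–(D7) listed in the context. Let $\Lambda_M>0$ be such that $$\|AP f\|^2 \geq \Lambda_M \|P f \|^2\quad\text{for all } f\in D,$$ and assume that the operator $(P A^2P,D)$ is essentially m-dissipative (or, respectively, essentially selfadjoint), that is, $(I - P A^2P)(D)$ is dense in $H$. Then $$\|AP f\|^2 \geq \Lambda_M \|P f \|^2\quad\text{for all } f \in D((AP)^*(AP)).$$
   Context: Data (D): (D1) $(E,\mathcal{F},\mu)$ is a probability space and $H=L^2(E,\mu)$ is the real Hilbert space with usual scalar product $(\cdot,\cdot)_H$ and norm $\|\cdot\|$. (D2) $(L,D(L))$ is a linear operator on $H$ generating a strongly continuous semigroup $(T(t))_{t\ge0}$. (D3) $D\subset D(L)$ is a dense subspace of $H$ which is a core for $(L,D(L))$. (D4) $(S,D(S))$ is a symmetric and $(A,D(A))$ a closed and antisymmetric linear operator on $H$ with $D\subset D(S)\cap D(A)$ and $L_{|D}=S-A$. (D5) $P:H\to H$ is an orthogonal projection with $P(H)\subset D(S)$, $SP=0$, $P(D)\subset D(A)$ and $AP(D)\subset D(A)$. Moreover $P_S:H\to H$, $P_Sf:=Pf+(f,1)_H$. (D6) $(Lf,1)_H=\int_E Lf\,\mathrm{d}\mu=0$ for all $f\in D$. (D7) $1\in D(L)$ and $L1=0$. $AP$ has domain $D(AP)=\{f\in H: Pf\in D(A)\}$, and $D((AP)^*(AP))=\{f\in D(AP): APf\in D((AP)^* )\}$. $PA^2P$ on $D$ means $f\mapsto P(A(A(Pf)))$. An operator is essentially m-dissipative if it is dissipative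 and its closure is m-dissipative. *)

theory Defs
  imports "HOL-Probability.Probability"
begin

text \<open>
  The space \<open>L\<^sup>2(M)\<close> depends on the term \<open>M\<close>, so it is not given by a type constructor.  Instead, a
  type \<open>'h\<close> of real Hilbert spaces is the space \<open>L\<^sup>2(M)\<close> by means of the map \<open>cls\<close> which
  sends a square integrable function to its class modulo equality almost everywhere.
  Values of \<open>cls\<close> outside \<open>square_integrable M\<close> are irrelevant.
\<close>

definition square_integrable :: "'a measure \<Rightarrow> ('a \<Rightarrow> real) set" where
  "square_integrable M = {f \<in> borel_measurable M. integrable M (\<lambda>x. (f x)\<^sup>2)}"

definition is_L2_space ::
    "'a measure \<Rightarrow> (('a \<Rightarrow> real) \<Rightarrow> 'h::{real_inner, complete_space}) \<Rightarrow> bool" where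
  "is_L2_space M cls \<longleftrightarrow>
     cls ` square_integrable M = UNIV \<and>
     (\<forall>f\<in>square_integrable M. \<forall>g\<in>square_integrable M. cls f = cls g \<longleftrightarrow> (AE x in M. f x = g x)) \<and>
     (\<forall>f\<in>square_integrable M. \<forall>g\<in>square_integrable M. cls (\<lambda>x. f x + g x) = cls f + cls g) \<and>
     (\<forall>c. \<forall>f\<in>square_integrable M. cls (\<lambda>x. c * f x) = c *\<^sub>R cls f) \<and>
     (\<forall>f\<in>square_integrable M. \<forall>g\<in>square_integrable M. cls f \<bullet> cls g = (\<integral>x. f x * g x \<partial>M))"

text \<open>
  An unbounded operator \<open>(B, D(B))\<close> is a domain \<open>DB\<close> together with a total function \<open>B\<close>, whose
  values outside \<open>DB\<close> are irrelevant; all notions below depend only on the graph over \<open>DB\<close>.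
\<close>

definition op_graph :: "'h set \<Rightarrow> ('h \<Rightarrow> 'h) \<Rightarrow> ('h \<times> 'h) set" where
  "op_graph DB B = {(f, B f) | f. f \<in> DB}"

definition linear_op :: "'h::real_vector set \<Rightarrow> ('h \<Rightarrow> 'h) \<Rightarrow> bool" where
  "linear_op DB B \<longleftrightarrow> subspace DB \<and>
     (\<forall>f\<in>DB. \<forall>g\<in>DB. B (f + g) = B f + B g) \<and> (\<forall>c. \<forall>f\<in>DB. B (c *\<^sub>R f) = c *\<^sub>R B f)"

definition dense_set :: "'h::topological_space set \<Rightarrow> bool" where
  "dense_set X \<longleftrightarrow> closure X = UNIV"

definition closed_op :: "'h::real_normed_vector set \<Rightarrow> ('h \<Rightarrow> 'h) \<Rightarrow> bool" where
  "closed_op DB B \<longleftrightarrow> closed (op_graph DB B)"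

text \<open>The existence of an operator \<open>(C, DC)\<close> with this property is closability of \<open>(B, DB)\<close>.\<close>

definition is_closure_op ::
    "'h::real_normed_vector set \<Rightarrow> ('h \<Rightarrow> 'h) \<Rightarrow> 'h set \<Rightarrow> ('h \<Rightarrow> 'h) \<Rightarrow> bool" where
  "is_closure_op DB B DC C \<longleftrightarrow> op_graph DC C = closure (op_graph DB B)"

definition is_core :: "'h::real_normed_vector set \<Rightarrow> 'h set \<Rightarrow> ('h \<Rightarrow> 'h) \<Rightarrow> bool" where
  "is_core D DB B \<longleftrightarrow> D \<subseteq> DB \<and> is_closure_op D B DB B"

definition symmetric_op :: "'h::real_inner set \<Rightarrow> ('h \<Rightarrow> 'h) \<Rightarrow> bool" where
  "symmetric_op DB B \<longleftrightarrow> (\<forall>f\<in>DB. \<forall>g\<in>DB. B f \<bullet> g = f \<bullet> B g)"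

definition antisymmetric_op :: "'h::real_inner set \<Rightarrow> ('h \<Rightarrow> 'h) \<Rightarrow> bool" where
  "antisymmetric_op DB B \<longleftrightarrow> (\<forall>f\<in>DB. \<forall>g\<in>DB. B f \<bullet> g = - (f \<bullet> B g))"

text \<open>Graph of the adjoint; for a subspace \<open>DB\<close> it is single-valued exactly when \<open>DB\<close> is dense.\<close>

definition adjoint_graph :: "'h::real_inner set \<Rightarrow> ('h \<Rightarrow> 'h) \<Rightarrow> ('h \<times> 'h) set" where
  "adjoint_graph DB B = {(g, h). \<forall>f\<in>DB. B f \<bullet> g = f \<bullet> h}"

definition adjoint_dom :: "'h::real_inner set \<Rightarrow> ('h \<Rightarrow> 'h) \<Rightarrow> 'h set" where
  "adjoint_dom DB B = Domain (adjoint_graph DB B)"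

definition selfadjoint_op :: "'h::real_inner set \<Rightarrow> ('h \<Rightarrow> 'h) \<Rightarrow> bool" where
  "selfadjoint_op DB B \<longleftrightarrow>
     linear_op DB B \<and> dense_set DB \<and> adjoint_graph DB B = op_graph DB B"

definition ess_selfadjoint_op :: "'h::real_inner set \<Rightarrow> ('h \<Rightarrow> 'h) \<Rightarrow> bool" where
  "ess_selfadjoint_op DB B \<longleftrightarrow>
     symmetric_op DB B \<and> (\<exists>DC C. is_closure_op DB B DC C \<and> selfadjoint_op DC C)"

definition dissipative_op :: "'h::real_inner set \<Rightarrow> ('h \<Rightarrow> 'h) \<Rightarrow> bool" where
  "dissipative_op DB B \<longleftrightarrow> linear_op DB B \<and> (\<forall>f\<in>DB. B f \<bullet> f \<le> 0)"

definition m_dissipative_op :: "'h::real_inner set \<Rightarrow> ('h \<Rightarrow> 'h) \<Rightarrow> bool" where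
  "m_dissipative_op DB B \<longleftrightarrow> dissipative_op DB B \<and> (\<lambda>f. f - B f) ` DB = UNIV"

definition ess_m_dissipative_op :: "'h::real_inner set \<Rightarrow> ('h \<Rightarrow> 'h) \<Rightarrow> bool" where
  "ess_m_dissipative_op DB B \<longleftrightarrow>
     dissipative_op DB B \<and> (\<exists>DC C. is_closure_op DB B DC C \<and> m_dissipative_op DC C)"

text \<open>Natural domain of the composition \<open>C B\<close> of the operators \<open>(C, DC)\<close> and \<open>(B, DB)\<close>.\<close>

definition comp_dom :: "'h set \<Rightarrow> 'h set \<Rightarrow> ('h \<Rightarrow> 'h) \<Rightarrow> 'h set" where
  "comp_dom DC DB B = {f \<in> DB. B f \<in> DC}"

definition orthogonal_projection :: "('h::real_inner \<Rightarrow> 'h) \<Rightarrow> bool" where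
  "orthogonal_projection P \<longleftrightarrow>
     bounded_linear P \<and> P \<circ> P = P \<and> (\<forall>f g. P f \<bullet> g = f \<bullet> P g)"

definition C0_semigroup :: "(real \<Rightarrow> 'h::real_normed_vector \<Rightarrow> 'h) \<Rightarrow> bool" where
  "C0_semigroup T \<longleftrightarrow>
     (\<forall>t\<ge>0. bounded_linear (T t)) \<and> T 0 = id \<and>
     (\<forall>s\<ge>0. \<forall>t\<ge>0. T (s + t) = T s \<circ> T t) \<and>
     (\<forall>f. ((\<lambda>t. T t f) \<longlongrightarrow> f) (at_right 0))"

definition is_generator ::
    "(real \<Rightarrow> 'h::real_normed_vector \<Rightarrow> 'h) \<Rightarrow> 'h set \<Rightarrow> ('h \<Rightarrow> 'h) \<Rightarrow> bool" where
  "is_generator T DL L \<longleftrightarrow>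
     op_graph DL L = {(f, g). ((\<lambda>t. (T t f - f) /\<^sub>R t) \<longlongrightarrow> g) (at_right 0)}"

locale hypocoercivity_data =
  fixes M :: "'a measure"
    and cls :: "('a \<Rightarrow> real) \<Rightarrow> 'h::{real_inner, complete_space}"
    and DL :: "'h set" and L :: "'h \<Rightarrow> 'h"
    and T :: "real \<Rightarrow> 'h \<Rightarrow> 'h"
    and D :: "'h set"
    and DS :: "'h set" and S :: "'h \<Rightarrow> 'h"
    and DA :: "'h set" and A :: "'h \<Rightarrow> 'h"
    and P :: "'h \<Rightarrow> 'h" and PS :: "'h \<Rightarrow> 'h"
  assumes D1: "prob_space M" "is_L2_space M cls"
    and D2: "linear_op DL L" "C0_semigroup T" "is_generator T DL L"
    and D3: "subspace D" "D \<subseteq> DL" "dense_set D" "is_core D DL L"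
    and D4: "linear_op DS S" "symmetric_op DS S"
            "linear_op DA A" "closed_op DA A" "antisymmetric_op DA A"
            "D \<subseteq> DS \<inter> DA" "\<And>f. f \<in> D \<Longrightarrow> L f = S f - A f"
    and D5: "orthogonal_projection P" "range P \<subseteq> DS" "\<And>f. S (P f) = 0"
            "P ` D \<subseteq> DA" "(\<lambda>f. A (P f)) ` D \<subseteq> DA"
            "\<And>f. PS f = P f + (f \<bullet> cls (\<lambda>_. 1)) *\<^sub>R cls (\<lambda>_. 1)"
    and D6: "\<And>f. f \<in> D \<Longrightarrow> L f \<bullet> cls (\<lambda>_. 1) = 0"
    and D7: "cls (\<lambda>_. 1) \<in> DL" "L (cls (\<lambda>_. 1)) = 0"

end

theory Submission
  imports Defs
begin

text \<open>
  Write \<open>G = AP\<close> on its natural domain and \<open>B = PA\<^sup>2P\<close> on \<open>D\<close>.  Antisymmetry of \<open>A\<close> and symmetry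
  of \<open>P\<close> give \<open>G x \<bullet> G g = - (x \<bullet> B g)\<close> for \<open>x\<close> in the domain of \<open>G\<close> and \<open>g \<in> D\<close>, so that \<open>-B\<close> is
  the restriction of \<open>G\<^sup>*G\<close> to \<open>D\<close>.  Let \<open>f\<close> lie in the domain of \<open>G\<^sup>*G\<close>.  Since \<open>(I - B)(D)\<close> is dense,
  there are \<open>u n \<in> D\<close> such that \<open>(I - B) (u n)\<close> tends to \<open>(I + G\<^sup>*G) f\<close>.  The error \<open>e = f - u n\<close> then
  satisfies \<open>\<parallel>e\<parallel>\<^sup>2 + \<parallel>G e\<parallel>\<^sup>2 = e \<bullet> (I + G\<^sup>*G) e\<close>, and \<open>(I + G\<^sup>*G) e\<close> tends to zero; hence \<open>u n\<close> tends to
  \<open>f\<close> and \<open>G (u n)\<close> to \<open>G f\<close> (\<open>core_approximation_in_graph_norm\<close>).  Both sides of the inequality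
  are continuous along such a sequence, and so the inequality passes from \<open>D\<close> to \<open>f\<close>.

  Density of \<open>(I - B)(D)\<close> follows from either notion of maximality of \<open>B\<close>.  If \<open>B\<close> is essentially
  m-dissipative with closure \<open>C\<close>, then the range of \<open>I - C\<close>, which is the whole space, lies in the
  closure of \<open>(I - B)(D)\<close> (\<open>dense_range_if_ess_m_dissipative\<close>).  If \<open>B\<close> is essentially selfadjoint, then a vector \<open>y\<close>
  orthogonal to \<open>(I - B)(D)\<close> satisfies \<open>C y = y\<close> for the closure \<open>C\<close> of \<open>B\<close>, and must vanish because
  \<open>B \<le> 0\<close> (\<open>dense_range_if_ess_selfadjoint\<close>); passing from a trivial orthogonal
  complement to density is the projection theorem in a Hilbert space.
\<close>

text \<open>
  The midpoint of two almost nearest points cannot be nearer than the distance to the set, so the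
  parallelogram law forces minimizing sequences to be Cauchy.
\<close>

lemma nearest_point_in_closed_convex_set:
  fixes W :: "'h::{real_inner, complete_space} set"
  assumes "closed W" "convex W" "W \<noteq> {}"
  obtains w where "w \<in> W" "\<And>v. v \<in> W \<Longrightarrow> dist y w \<le> dist y v"
proof -
  define d where "d = infdist y W"
  have d_le: "d \<le> dist y v" if "v \<in> W" for v
    unfolding d_def using that by (rule infdist_le)
  have d_nonneg: "0 \<le> d"
    by (simp add: d_def infdist_nonneg)
  \<comment> \<open>The bound is on squared distances because these are what the parallelogram law combines.\<close>
  have "\<exists>v\<in>W. (dist y v)\<^sup>2 < d\<^sup>2 + inverse (real (Suc n))" for n
  proof -
    have "infdist y W < sqrt (d\<^sup>2 + inverse (real (Suc n)))"
      unfolding d_def[symmetric] by (rule real_less_rsqrt) simp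
    then obtain v where "v \<in> W" "dist y v < sqrt (d\<^sup>2 + inverse (real (Suc n)))"
      using \<open>W \<noteq> {}\<close> by (auto simp: infdist_def cINF_less_iff)
    then have "(dist y v)\<^sup>2 < (sqrt (d\<^sup>2 + inverse (real (Suc n))))\<^sup>2"
      by (intro power_strict_mono) auto
    with \<open>v \<in> W\<close> show ?thesis
      by (intro bexI[of _ v]) (simp_all add: add_nonneg_nonneg)
  qed
  then obtain x where xW: "\<And>n. x n \<in> W"
    and x_dist: "\<And>n. (dist y (x n))\<^sup>2 < d\<^sup>2 + inverse (real (Suc n))"
    by metis
  have gap: "(dist (x m) (x n))\<^sup>2 \<le> 2 * inverse (real (Suc m)) + 2 * inverse (real (Suc n))" for m n
  proof -
    let ?c = "(1/2) *\<^sub>R x m + (1/2) *\<^sub>R x n"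
    have "?c \<in> W"
      using convexD[OF \<open>convex W\<close> xW xW, of "1/2" "1/2"] by simp
    then have "d\<^sup>2 \<le> (dist y ?c)\<^sup>2"
      using d_le d_nonneg by (intro power_mono) auto
    moreover have "(dist (x m) (x n))\<^sup>2 + 4 * (dist y ?c)\<^sup>2 = 2 * (dist y (x m))\<^sup>2 + 2 * (dist y (x n))\<^sup>2"
      by (simp add: dist_norm power2_norm_eq_inner algebra_simps inner_commute)
    ultimately show ?thesis
      using x_dist[of m] x_dist[of n] by linarith
  qed
  have "Cauchy x"
  proof (rule metric_CauchyI)
    fix e :: real assume "0 < e"
    then obtain N where N: "inverse (real (Suc N)) < e\<^sup>2 / 4"
      using reals_Archimedean[of "e\<^sup>2 / 4"] by auto
    have "dist (x m) (x n) < e" if "N \<le> m" "N \<le> n" for m n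
    proof -
      have "inverse (real (Suc m)) \<le> inverse (real (Suc N))"
        "inverse (real (Suc n)) \<le> inverse (real (Suc N))"
        using that by auto
      with gap[of m n] N have "(dist (x m) (x n))\<^sup>2 < e\<^sup>2"
        by linarith
      then show ?thesis
        using \<open>0 < e\<close> by (simp add: power2_less_imp_less)
    qed
    then show "\<exists>N. \<forall>m\<ge>N. \<forall>n\<ge>N. dist (x m) (x n) < e"
      by blast
  qed
  then obtain w where w: "x \<longlonglongrightarrow> w"
    by (auto simp: Cauchy_convergent_iff convergent_def)
  have "w \<in> W"
    using \<open>closed W\<close> xW w by (rule closed_sequentially)
  have "(\<lambda>n. (dist y (x n))\<^sup>2) \<longlonglongrightarrow> (dist y w)\<^sup>2"
    by (intro tendsto_intros w)
  moreover have "(\<lambda>n. d\<^sup>2 + inverse (real (Suc n))) \<longlonglongrightarrow> d\<^sup>2 + 0"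
    by (intro tendsto_intros LIMSEQ_inverse_real_of_nat)
  ultimately have "(dist y w)\<^sup>2 \<le> d\<^sup>2 + 0"
    by (rule LIMSEQ_le) (meson less_imp_le x_dist)
  then have "dist y w \<le> d"
    using d_nonneg power2_le_imp_le by auto
  with \<open>w \<in> W\<close> d_le show thesis
    using that by (meson order_trans)
qed

lemma subspace_closure:
  fixes W :: "'a::real_normed_vector set"
  assumes "subspace W"
  shows "subspace (closure W)"
proof (rule subspaceI)
  show "0 \<in> closure W"
    using assms closure_subset[of W] subspace_0 by blast
next
  fix x y assume "x \<in> closure W" "y \<in> closure W"
  then obtain a b where "\<And>n. a n \<in> W" "a \<longlonglongrightarrow> x" "\<And>n. b n \<in> W" "b \<longlonglongrightarrow> y"
    by (auto simp: closure_sequential)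
  then have "\<And>n. a n + b n \<in> W" "(\<lambda>n. a n + b n) \<longlonglongrightarrow> x + y"
    using assms by (auto intro: subspace_add tendsto_add)
  then show "x + y \<in> closure W"
    unfolding closure_sequential by (intro exI[of _ "\<lambda>n. a n + b n"]) blast
next
  fix c x assume "x \<in> closure W"
  then obtain a where "\<And>n. a n \<in> W" "a \<longlonglongrightarrow> x"
    by (auto simp: closure_sequential)
  then have "\<And>n. c *\<^sub>R a n \<in> W" "(\<lambda>n. c *\<^sub>R a n) \<longlonglongrightarrow> c *\<^sub>R x"
    using assms by (auto intro: subspace_mul tendsto_intros)
  then show "c *\<^sub>R x \<in> closure W"
    unfolding closure_sequential by (intro exI[of _ "\<lambda>n. c *\<^sub>R a n"]) blast
qed

text \<open>
  The difference between \<open>y\<close> and the point of the closure of \<open>W\<close> nearest to \<open>y\<close> is orthogonal to \<open>W\<close>.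
\<close>

lemma subspace_dense_if_orthogonal_complement_trivial:
  fixes W :: "'h::{real_inner, complete_space} set"
  assumes "subspace W" and "\<And>y. (\<And>w. w \<in> W \<Longrightarrow> w \<bullet> y = 0) \<Longrightarrow> y = 0"
  shows "dense_set W"
proof -
  have cl: "subspace (closure W)"
    using \<open>subspace W\<close> by (rule subspace_closure)
  have "y \<in> closure W" for y
  proof -
    obtain w where w: "w \<in> closure W" and near: "\<And>v. v \<in> closure W \<Longrightarrow> dist y w \<le> dist y v"
      using nearest_point_in_closed_convex_set[of "closure W" y] cl
      by (metis closed_closure empty_iff subspace_0 subspace_imp_convex)
    have le: "v \<bullet> (y - w) \<le> 0" if "v \<in> closure W" for v
      using any_closest_point_dot[of "closure W" w "w + v" y] cl w near that
      by (simp add: subspace_imp_convex subspace_add inner_commute)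
    have "v \<bullet> (y - w) = 0" if "v \<in> W" for v
    proof -
      have "v \<in> closure W" "- v \<in> closure W"
        using that closure_subset[of W] subspace_neg[OF cl] by blast+
      from le[OF this(1)] le[OF this(2)] show ?thesis
        by simp
    qed
    then have "y - w = 0"
      using assms(2) by blast
    with w show ?thesis
      by simp
  qed
  then show ?thesis
    by (auto simp: dense_set_def)
qed

text \<open>
  The range of \<open>I - C\<close> is the image of the graph of \<open>C\<close> under the continuous map \<open>(f, g) \<mapsto> f - g\<close>, and
  a continuous map sends the closure of a set into the closure of its image.
\<close>

lemma dense_range_if_ess_m_dissipative:
  assumes "ess_m_dissipative_op D B"
  shows "dense_set ((\<lambda>f. f - B f) ` D)"
proof -
  obtain DC C where C: "op_graph DC C = closure (op_graph D B)" "(\<lambda>f. f - C f) ` DC = UNIV"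
    using assms by (auto simp: ess_m_dissipative_op_def is_closure_op_def m_dissipative_op_def)
  let ?s = "\<lambda>(f, g). f - g :: 'a"
  have "continuous_on UNIV ?s"
    by (auto simp: case_prod_unfold intro!: continuous_intros)
  then have "?s ` closure (op_graph D B) \<subseteq> closure (?s ` op_graph D B)"
    by (intro image_closure_subset) (auto intro: continuous_on_subset closure_subset[THEN subsetD])
  moreover have "?s ` op_graph D B = (\<lambda>f. f - B f) ` D" "?s ` op_graph DC C = (\<lambda>f. f - C f) ` DC"
    by (force simp: op_graph_def)+
  ultimately show ?thesis
    using C by (auto simp: dense_set_def)
qed

text \<open>
  That \<open>y\<close> is orthogonal to the range of \<open>I - B\<close> means that \<open>(y, y)\<close> is in the graph of the adjoint,
  which for essentially selfadjoint \<open>B\<close> is the closure of the graph of \<open>B\<close>.  The sign condition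
  extends to this closure and gives \<open>y \<bullet> y \<le> 0\<close>.
\<close>

lemma dense_range_if_ess_selfadjoint:
  fixes B :: "'h::{real_inner, complete_space} \<Rightarrow> 'h"
  assumes "linear_op D B" "ess_selfadjoint_op D B" and neg: "\<And>f. f \<in> D \<Longrightarrow> B f \<bullet> f \<le> 0"
  shows "dense_set ((\<lambda>f. f - B f) ` D)"
proof (rule subspace_dense_if_orthogonal_complement_trivial)
  show "subspace ((\<lambda>f. f - B f) ` D)"
  proof (rule subspaceI)
    have "0 \<in> D"
      using assms(1) by (simp add: linear_op_def subspace_0)
    moreover from this have "B (0 *\<^sub>R 0) = 0 *\<^sub>R B 0"
      using assms(1) unfolding linear_op_def by blast
    ultimately show "0 \<in> (\<lambda>f. f - B f) ` D"
      by (intro image_eqI[of _ _ 0]) auto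
  next
    fix x y assume "x \<in> (\<lambda>f. f - B f) ` D" "y \<in> (\<lambda>f. f - B f) ` D"
    then obtain f g where "f \<in> D" "g \<in> D" "x = f - B f" "y = g - B g"
      by blast
    then have "f + g \<in> D" "x + y = (f + g) - B (f + g)"
      using assms(1) by (auto simp: linear_op_def subspace_add)
    then show "x + y \<in> (\<lambda>f. f - B f) ` D"
      by blast
  next
    fix c x assume "x \<in> (\<lambda>f. f - B f) ` D"
    then obtain f where "f \<in> D" "x = f - B f"
      by blast
    then have "c *\<^sub>R f \<in> D" "c *\<^sub>R x = c *\<^sub>R f - B (c *\<^sub>R f)"
      using assms(1) by (auto simp: linear_op_def subspace_mul scaleR_diff_right)
    then show "c *\<^sub>R x \<in> (\<lambda>f. f - B f) ` D"
      by blast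
  qed
next
  fix y assume orth: "\<And>w. w \<in> (\<lambda>f. f - B f) ` D \<Longrightarrow> w \<bullet> y = 0"
  obtain DC C where C: "op_graph DC C = closure (op_graph D B)" "adjoint_graph DC C = op_graph DC C"
    using assms(2) by (auto simp: ess_selfadjoint_op_def is_closure_op_def selfadjoint_op_def)
  have "closure (op_graph D B) \<subseteq> {p. snd p \<bullet> y = fst p \<bullet> y}"
  proof (rule closure_minimal)
    show "op_graph D B \<subseteq> {p. snd p \<bullet> y = fst p \<bullet> y}"
      using orth[OF imageI] by (auto simp: op_graph_def inner_diff_left)
    show "closed {p. snd p \<bullet> y = fst p \<bullet> y}"
      by (intro closed_Collect_eq continuous_intros)
  qed
  \<comment> \<open>An operator and its closure have the same adjoint, since the defining equation is closed.\<close>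
  then have "(y, y) \<in> adjoint_graph DC C"
    unfolding C(1)[symmetric] by (auto simp: adjoint_graph_def op_graph_def)
  then have "(y, y) \<in> closure (op_graph D B)"
    using C by simp
  moreover have "closure (op_graph D B) \<subseteq> {p. snd p \<bullet> fst p \<le> 0}"
  proof (rule closure_minimal)
    show "op_graph D B \<subseteq> {p. snd p \<bullet> fst p \<le> 0}"
      using neg by (auto simp: op_graph_def)
    show "closed {p :: 'h \<times> 'h. snd p \<bullet> fst p \<le> 0}"
      by (intro closed_Collect_le continuous_intros)
  qed
  ultimately have "y \<bullet> y \<le> 0"
    by auto
  then show "y = 0"
    by (meson inner_gt_zero_iff not_le)
qed

text \<open>
  The hypothesis \<open>weak\<close> says that \<open>- B g\<close> is a value of \<open>G\<^sup>*\<close> at \<open>G g\<close> for \<open>g \<in> D\<close>.  Hence \<open>D\<close> lies in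
  the domain of \<open>G\<^sup>*G\<close>, and the conclusion is its density there for the graph norm of \<open>G\<close>: testing \<open>(I + G\<^sup>*G) e = r\<close> with \<open>e\<close> itself
  bounds both \<open>\<parallel>e\<parallel>\<close> and \<open>\<parallel>G e\<parallel>\<close> by \<open>\<parallel>r\<parallel>\<close>.
\<close>

lemma core_approximation_in_graph_norm:
  fixes G :: "'h::real_inner \<Rightarrow> 'h"
  assumes "linear_op DG G" "D \<subseteq> DG"
    and weak: "\<And>x g. x \<in> DG \<Longrightarrow> g \<in> D \<Longrightarrow> G x \<bullet> G g = - (x \<bullet> B g)"
    and dense: "dense_set ((\<lambda>f. f - B f) ` D)"
    and f: "f \<in> comp_dom (adjoint_dom DG G) DG G"
  obtains u where "\<And>n. u n \<in> D" "u \<longlonglongrightarrow> f" "(\<lambda>n. G (u n)) \<longlonglongrightarrow> G f"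
proof -
  have fD: "f \<in> DG"
    using f by (simp add: comp_dom_def)
  obtain h where h: "\<And>x. x \<in> DG \<Longrightarrow> G x \<bullet> G f = x \<bullet> h"
    using f by (auto simp: comp_dom_def adjoint_dom_def adjoint_graph_def)
  \<comment> \<open>Here \<open>h\<close> is a value of \<open>G\<^sup>*G f\<close>, and the residual \<open>r\<close> below is \<open>(I + G\<^sup>*G) (f - u n)\<close>.\<close>
  have "f + h \<in> closure ((\<lambda>f. f - B f) ` D)"
    using dense by (simp add: dense_set_def)
  then obtain v where v: "\<And>n. v n \<in> (\<lambda>f. f - B f) ` D" "v \<longlonglongrightarrow> f + h"
    by (auto simp: closure_sequential)
  then have "\<forall>n. \<exists>g. g \<in> D \<and> v n = g - B g"
    by blast
  then obtain u where u: "\<And>n. u n \<in> D" "\<And>n. v n = u n - B (u n)"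
    by metis
  define r where "r n = f + h - v n" for n
  have "(\<lambda>n. norm (r n)) \<longlonglongrightarrow> norm (f + h - (f + h))"
    unfolding r_def by (intro tendsto_intros v(2))
  then have r0: "(\<lambda>n. norm (r n)) \<longlonglongrightarrow> 0"
    by simp
  have le: "norm (u n - f) \<le> norm (r n) \<and> norm (G (u n) - G f) \<le> norm (r n)" for n
  proof -
    let ?x = "f - u n"
    have uD: "u n \<in> DG"
      using u(1) \<open>D \<subseteq> DG\<close> by blast
    have xD: "?x \<in> DG"
      using assms(1) fD uD by (simp add: linear_op_def subspace_diff)
    have "G (f + (-1) *\<^sub>R u n) = G f + (-1) *\<^sub>R G (u n)"
      using assms(1) fD uD unfolding linear_op_def by (metis subspace_mul)
    then have Gx: "G ?x = G f - G (u n)"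
      by simp
    have "(norm ?x)\<^sup>2 + (norm (G ?x))\<^sup>2 = ?x \<bullet> ?x + (G ?x \<bullet> G f - G ?x \<bullet> G (u n))"
      unfolding power2_norm_eq_inner by (metis Gx inner_diff_right)
    also have "\<dots> = ?x \<bullet> r n"
      using h[OF xD] weak[OF xD u(1)] by (simp add: r_def u(2) inner_simps)
    also have "\<dots> \<le> norm ?x * norm (r n)"
      by (rule norm_cauchy_schwarz)
    finally have *: "(norm ?x)\<^sup>2 + (norm (G ?x))\<^sup>2 \<le> norm ?x * norm (r n)" .
    then have "norm ?x * norm ?x \<le> norm ?x * norm (r n)"
      unfolding power2_eq_square by (smt (verit) zero_le_square)
    then have x: "norm ?x \<le> norm (r n)"
      by (cases "norm ?x = 0") auto
    then have "norm ?x * norm (r n) \<le> (norm (r n))\<^sup>2"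
      unfolding power2_eq_square by (intro mult_right_mono) auto
    with * have "(norm (G ?x))\<^sup>2 \<le> (norm (r n))\<^sup>2"
      by (smt (verit) zero_le_power2)
    then have "norm (G ?x) \<le> norm (r n)"
      by (rule power2_le_imp_le) simp
    with x Gx show ?thesis
      by (simp add: norm_minus_commute)
  qed
  have "u \<longlonglongrightarrow> f" "(\<lambda>n. G (u n)) \<longlonglongrightarrow> G f"
    unfolding LIM_zero_iff[of u, symmetric] LIM_zero_iff[of "\<lambda>n. G (u n)", symmetric]
    by (rule Lim_null_comparison[OF _ r0]; simp add: le)+
  with u(1) show thesis
    using that by blast
qed

theorem corollary2p13:
  fixes M :: "'a measure"
    and cls :: "('a \<Rightarrow> real) \<Rightarrow> 'h::{real_inner, complete_space}"
    and DL D DS DA :: "'h set"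
    and L S A P PS :: "'h \<Rightarrow> 'h"
    and T :: "real \<Rightarrow> 'h \<Rightarrow> 'h"
    and \<Lambda>\<^sub>M :: real
  assumes "hypocoercivity_data M cls DL L T D DS S DA A P PS"
    and "\<Lambda>\<^sub>M > 0"
    and "\<And>f. f \<in> D \<Longrightarrow> (norm (A (P f)))\<^sup>2 \<ge> \<Lambda>\<^sub>M * (norm (P f))\<^sup>2"
    and "ess_m_dissipative_op D (\<lambda>f. P (A (A (P f)))) \<or>
         ess_selfadjoint_op D (\<lambda>f. P (A (A (P f)))) \<or>
         dense_set ((\<lambda>f. f - P (A (A (P f)))) ` D)"
  shows "\<forall>f \<in> comp_dom
           (adjoint_dom (comp_dom DA UNIV P) (\<lambda>f. A (P f)))
           (comp_dom DA UNIV P) (\<lambda>f. A (P f)).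
         (norm (A (P f)))\<^sup>2 \<ge> \<Lambda>\<^sub>M * (norm (P f))\<^sup>2"
proof
  interpret hypocoercivity_data M cls DL L T D DS S DA A P PS
    by fact
  let ?DG = "comp_dom DA UNIV P"
  let ?G = "\<lambda>f. A (P f)"
  let ?B = "\<lambda>f. P (A (A (P f)))"
  have P: "bounded_linear P" and Psym: "P f \<bullet> g = f \<bullet> P g" for f g
    using D5(1) by (auto simp: orthogonal_projection_def)
  interpret P: bounded_linear P
    by fact
  have linG: "linear_op ?DG ?G"
    using D4(3) by (auto simp: linear_op_def comp_dom_def subspace_def P.add P.scaleR P.zero)
  have DG: "D \<subseteq> ?DG"
    using D5(4) by (auto simp: comp_dom_def)
  have linB: "linear_op D ?B"
    using D3(1) D4(3) D5(4,5) unfolding linear_op_def image_subset_iff by (simp add: P.add P.scaleR)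
  have weak: "?G x \<bullet> ?G g = - (x \<bullet> ?B g)" if "x \<in> ?DG" "g \<in> D" for x g
    using that D4(5) D5(5) Psym by (auto simp: antisymmetric_op_def comp_dom_def image_subset_iff)
  have neg: "?B g \<bullet> g \<le> 0" if "g \<in> D" for g
    using weak[of g g] that DG by (metis inner_commute inner_ge_zero neg_0_le_iff_le subsetD)
  have dense: "dense_set ((\<lambda>f. f - ?B f) ` D)"
    using assms(4) dense_range_if_ess_m_dissipative dense_range_if_ess_selfadjoint[OF linB _ neg]
    by blast
  fix f assume "f \<in> comp_dom (adjoint_dom ?DG ?G) ?DG ?G"
  then obtain u where u: "\<And>n. u n \<in> D" "u \<longlonglongrightarrow> f" "(\<lambda>n. ?G (u n)) \<longlonglongrightarrow> ?G f"
    using core_approximation_in_graph_norm[OF linG DG weak dense] by blast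
  have "(\<lambda>n. \<Lambda>\<^sub>M * (norm (P (u n)))\<^sup>2) \<longlonglongrightarrow> \<Lambda>\<^sub>M * (norm (P f))\<^sup>2"
    by (intro tendsto_intros P.tendsto u(2))
  moreover have "(\<lambda>n. (norm (?G (u n)))\<^sup>2) \<longlonglongrightarrow> (norm (?G f))\<^sup>2"
    by (intro tendsto_intros u(3))
  ultimately show "\<Lambda>\<^sub>M * (norm (P f))\<^sup>2 \<le> (norm (?G f))\<^sup>2"
    by (rule LIMSEQ_le) (use assms(3) u(1) in blast)
qed

end
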